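(* Let $A,B\in gl(2,\mathbb{R})$ and let $\mathcal{L}_{\Sigma}\subset gl(2,\mathbb{R})$ be the Lie algebra generated by the matrices $A+uB$, $u\in\mathbb{R}$. The bilinear control system $\Sigma:\ \dot{x}=(A+uB)x$ satisfies the Lie algebra rank condition on $\mathbb{R}^2\smallsetminus\{0\}$, i.e. $\dim \mathcal{L}_{\Sigma}(x)=2$ for all $x\in\mathbb{R}^2\smallsetminus\{0\}$, if and only if there exist $\tilde{A}$ and $\tilde{B}$ in $\mathcal{L}_{\Sigma}$ such that $$\mathrm{tr}^2\big(\mathrm{adj}(\tilde{A})\tilde{B}\big)-4\det\big(\mathrm{adj}(\tilde{A})\tilde{B}\big)<0,$$ where $\mathrm{adj}(\tilde{A})$ is the classical adjoint matrix of $\tilde{A}$.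
   Context: $gl(2,\mathbb{R})$ is the Lie algebra of real $2\times 2$ matrices with bracket $[X,Y]=XY-YX$. $\mathcal{L}_{\Sigma}$ is the smallest real Lie subalgebra of $gl(2,\mathbb{R})$ containing all $A+uB$, $u\in\mathbb{R}$ (equivalently, containing $A$ and $B$). For $x\in\mathbb{R}^2$, $\mathcal{L}_{\Sigma}(x)=\{Cx : C\in\mathcal{L}_{\Sigma}\}\subset\mathbb{R}^2$. The classical adjoint (adjugate) of $A\in gl(2,\mathbb{R})$ is $\mathrm{adj}(A)=\mathrm{tr}(A)I_2-A$. $\mathrm{tr}^2(X)$ denotes $(\mathrm{tr}\,X)^2$. *)

theory Defs
  imports "HOL-Analysis.Analysis"
begin

definition lie_bracket :: "real^2^2 \<Rightarrow> real^2^2 \<Rightarrow> real^2^2" where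
  "lie_bracket X Y = X ** Y - Y ** X"

definition lie_subalgebra :: "(real^2^2) set \<Rightarrow> bool" where
  "lie_subalgebra L \<longleftrightarrow> subspace L \<and> (\<forall>X\<in>L. \<forall>Y\<in>L. lie_bracket X Y \<in> L)"

text \<open>The Lie algebra of the system \<open>x' = (A + u B) x\<close>: the intersection of all Lie
  subalgebras containing every \<open>A + u B\<close>, which is itself a Lie subalgebra.\<close>

definition system_lie_algebra :: "real^2^2 \<Rightarrow> real^2^2 \<Rightarrow> (real^2^2) set" where
  "system_lie_algebra A B = lie_subalgebra hull (range (\<lambda>u::real. A + u *\<^sub>R B))"

definition lie_algebra_at :: "real^2^2 \<Rightarrow> real^2^2 \<Rightarrow> real^2 \<Rightarrow> (real^2) set" where
  "lie_algebra_at A B x = (\<lambda>C. C *v x) ` system_lie_algebra A B"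

definition lie_algebra_rank_condition :: "real^2^2 \<Rightarrow> real^2^2 \<Rightarrow> bool" where
  "lie_algebra_rank_condition A B \<longleftrightarrow> (\<forall>x\<in>UNIV - {0}. dim (lie_algebra_at A B x) = 2)"

definition adj :: "real^2^2 \<Rightarrow> real^2^2" where
  "adj A = trace A *\<^sub>R mat 1 - A"

end

theory Submission
  imports Defs
begin

text \<open>The discriminant in the statement is that of the binary quadratic form
  \<open>x \<mapsto> det [A' x | B' x]\<close>, so it is negative iff \<open>A' x\<close> and \<open>B' x\<close> are independent for every
  \<open>x \<noteq> 0\<close>. Conversely only the linear structure of the Lie algebra \<open>L\<close> matters. If \<open>dim L \<le> 2\<close>,
  a spanning pair of \<open>L\<close> works. If \<open>dim L = 3\<close>, then \<open>L\<close> is the orthogonal complement of some \<open>N\<close>;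
  the rank condition excludes a singular \<open>N\<close>, whose rank-one factorisation \<open>N = y x\<^sup>T\<close> would give
  \<open>y \<bullet> C x = N \<bullet> C = 0\<close> on \<open>L\<close>, and for invertible \<open>N\<close> the space \<open>L\<close> is the image of the traceless
  matrices under \<open>adj N\<^sup>T\<close>, which contains such a pair.\<close>

text \<open>Completing the square: the discriminant times \<open>y\<^sup>2\<close> is a square minus
  a multiple of the value of the form, and likewise with \<open>x\<^sup>2\<close>, so it is
  nonnegative at a nontrivial zero.\<close>

lemma binary_form_isotropic_iff:
  fixes a b c :: real
  shows "(\<exists>x y. (x \<noteq> 0 \<or> y \<noteq> 0) \<and> a * x\<^sup>2 + b * x * y + c * y\<^sup>2 = 0) \<longleftrightarrow> 0 \<le> b\<^sup>2 - 4 * a * c"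
proof
  assume "\<exists>x y. (x \<noteq> 0 \<or> y \<noteq> 0) \<and> a * x\<^sup>2 + b * x * y + c * y\<^sup>2 = 0"
  then obtain x y where xy: "x \<noteq> 0 \<or> y \<noteq> 0" and z: "a * x\<^sup>2 + b * x * y + c * y\<^sup>2 = 0"
    by blast
  have "(b\<^sup>2 - 4 * a * c) * y\<^sup>2 = (2 * a * x + b * y)\<^sup>2 - 4 * a * (a * x\<^sup>2 + b * x * y + c * y\<^sup>2)"
    by (simp add: power2_eq_square algebra_simps)
  then have y: "0 \<le> (b\<^sup>2 - 4 * a * c) * y\<^sup>2"
    using z by simp
  have "(b\<^sup>2 - 4 * a * c) * x\<^sup>2 = (2 * c * y + b * x)\<^sup>2 - 4 * c * (a * x\<^sup>2 + b * x * y + c * y\<^sup>2)"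
    by (simp add: power2_eq_square algebra_simps)
  then have x: "0 \<le> (b\<^sup>2 - 4 * a * c) * x\<^sup>2"
    using z by simp
  from xy x y show "0 \<le> b\<^sup>2 - 4 * a * c"
    by (auto simp: zero_le_mult_iff)
next
  assume d: "0 \<le> b\<^sup>2 - 4 * a * c"
  show "\<exists>x y. (x \<noteq> 0 \<or> y \<noteq> 0) \<and> a * x\<^sup>2 + b * x * y + c * y\<^sup>2 = 0"
  proof (cases "a = 0")
    case True
    then show ?thesis
      by (intro exI[of _ 1] exI[of _ 0]) simp
  next
    case False
    define s where "s = sqrt (b\<^sup>2 - 4 * a * c)"
    have s: "s * s = b * b - 4 * a * c"
      using d by (simp add: s_def power2_eq_square)
    \<comment> \<open>The quadratic formula in homogeneous coordinates: the root
      \<open>(s - b) / (2 * a)\<close> becomes the zero \<open>(s - b, 2 * a)\<close>.\<close>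
    have "a * (s - b)\<^sup>2 + b * (s - b) * (2 * a) + c * (2 * a)\<^sup>2 = a * (s * s - (b * b - 4 * a * c))"
      by (simp add: power2_eq_square algebra_simps)
    then show ?thesis
      using False s by (intro exI[of _ "s - b"] exI[of _ "2 * a"]) simp
  qed
qed

lemma vec2_eq_0_iff: "(x :: real^2) = 0 \<longleftrightarrow> x $ 1 = 0 \<and> x $ 2 = 0"
  by (simp add: vec_eq_iff forall_2)

lemma inner_vec2: "(x :: real^2) \<bullet> y = x $ 1 * y $ 1 + x $ 2 * y $ 2"
  by (simp add: inner_vec_def sum_2)

lemma inner_mat2:
  "(N :: real^2^2) \<bullet> C =
    N $ 1 $ 1 * C $ 1 $ 1 + N $ 1 $ 2 * C $ 1 $ 2 + N $ 2 $ 1 * C $ 2 $ 1 + N $ 2 $ 2 * C $ 2 $ 2"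
  by (simp add: inner_vec_def sum_2)

lemma mult_vec2: "((C :: real^2^2) *v x) $ i = C $ i $ 1 * x $ 1 + C $ i $ 2 * x $ 2"
  by (simp add: matrix_vector_mult_def sum_2)

lemmas matrix_2_simps = adj_def trace_def det_2 matrix_matrix_mult_def sum_2 mat_def

text \<open>The determinant of the matrix with columns \<open>u\<close> and
  \<open>v\<close>.\<close>

definition cross2 :: "real^2 \<Rightarrow> real^2 \<Rightarrow> real" where
  "cross2 u v = u $ 1 * v $ 2 - u $ 2 * v $ 1"

lemma cross2_eq_0_iff:
  "cross2 u v = 0 \<longleftrightarrow> (\<exists>y. y \<noteq> 0 \<and> y \<bullet> u = 0 \<and> y \<bullet> v = 0)"
proof
  assume c: "cross2 u v = 0"
  consider "u \<noteq> 0" | "v \<noteq> 0" | "u = 0" "v = 0" by blast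
  then show "\<exists>y. y \<noteq> 0 \<and> y \<bullet> u = 0 \<and> y \<bullet> v = 0"
  proof cases
    case 1
    then show ?thesis
      \<comment> \<open>The quarter turn of \<open>u\<close> is orthogonal to \<open>u\<close>, and
        its inner product with \<open>v\<close> is \<open>cross2 u v\<close>.\<close>
      using c by (intro exI[of _ "vector [- u $ 2, u $ 1]"])
        (auto simp: cross2_def vec2_eq_0_iff inner_vec2)
  next
    case 2
    then show ?thesis
      using c by (intro exI[of _ "vector [- v $ 2, v $ 1]"])
        (auto simp: cross2_def vec2_eq_0_iff inner_vec2 algebra_simps)
  next
    case 3
    then show ?thesis
      by (intro exI[of _ "vector [1, 0]"]) (simp add: vec2_eq_0_iff inner_vec2)
  qed
next
  assume "\<exists>y. y \<noteq> 0 \<and> y \<bullet> u = 0 \<and> y \<bullet> v = 0"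
  then obtain y where y: "y \<noteq> 0" "y \<bullet> u = 0" "y \<bullet> v = 0" by blast
  \<comment> \<open>Cramer's rule for the linear system \<open>y \<bullet> u = 0\<close>,
    \<open>y \<bullet> v = 0\<close> in the unknown \<open>y\<close>.\<close>
  have "y $ 1 * cross2 u v = v $ 2 * (y \<bullet> u) - u $ 2 * (y \<bullet> v)"
    "y $ 2 * cross2 u v = u $ 1 * (y \<bullet> v) - v $ 1 * (y \<bullet> u)"
    by (simp_all add: cross2_def inner_vec2 algebra_simps)
  with y show "cross2 u v = 0"
    by (auto simp: vec2_eq_0_iff)
qed

text \<open>For \<open>M = adj A ** B\<close> one has
  \<open>cross2 (A *v x) (B *v x) = cross2 x (M *v x)\<close>, which vanishes at a nonzero
  \<open>x\<close> iff \<open>x\<close> is an eigenvector of \<open>M\<close>. The left side is the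
  discriminant of the characteristic polynomial of \<open>M\<close>.\<close>

lemma discriminant_neg_iff:
  fixes A B :: "real^2^2"
  shows "(trace (adj A ** B))\<^sup>2 - 4 * det (adj A ** B) < 0 \<longleftrightarrow>
    (\<forall>x. x \<noteq> 0 \<longrightarrow> cross2 (A *v x) (B *v x) \<noteq> 0)"
proof -
  define M where "M = adj A ** B"
  have form: "cross2 (A *v x) (B *v x) =
      M $ 2 $ 1 * (x $ 1)\<^sup>2 + (M $ 2 $ 2 - M $ 1 $ 1) * x $ 1 * x $ 2 + (- M $ 1 $ 2) * (x $ 2)\<^sup>2" for x
    by (simp add: M_def cross2_def mult_vec2 matrix_2_simps power2_eq_square algebra_simps)
  have "(\<exists>x. x \<noteq> 0 \<and> cross2 (A *v x) (B *v x) = 0) \<longleftrightarrow>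
      (\<exists>s t. (s \<noteq> 0 \<or> t \<noteq> 0) \<and>
        M $ 2 $ 1 * s\<^sup>2 + (M $ 2 $ 2 - M $ 1 $ 1) * s * t + (- M $ 1 $ 2) * t\<^sup>2 = 0)"
    (is "?l \<longleftrightarrow> ?r")
  proof
    assume ?l
    then show ?r
      unfolding form vec2_eq_0_iff by blast
  next
    assume ?r
    then obtain s t where "s \<noteq> 0 \<or> t \<noteq> 0"
      "M $ 2 $ 1 * s\<^sup>2 + (M $ 2 $ 2 - M $ 1 $ 1) * s * t + (- M $ 1 $ 2) * t\<^sup>2 = 0"
      by blast
    then show ?l
      unfolding form vec2_eq_0_iff by (intro exI[of _ "vector [s, t]"]) simp
  qed
  moreover have "(M $ 2 $ 2 - M $ 1 $ 1)\<^sup>2 - 4 * M $ 2 $ 1 * (- M $ 1 $ 2) = (trace M)\<^sup>2 - 4 * det M"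
    by (simp add: trace_def sum_2 det_2 power2_eq_square algebra_simps)
  ultimately show ?thesis
    unfolding binary_form_isotropic_iff M_def by (metis not_less)
qed

text \<open>A set of deficient dimension spans a subspace of some hyperplane, with normal
  \<open>y\<close>. This serves both for vectors of the plane and for matrices, seen as a Euclidean
  space of dimension 4.\<close>

lemma dim_less_DIM_iff:
  fixes S :: "'a::euclidean_space set"
  shows "dim S < DIM('a) \<longleftrightarrow> (\<exists>y. y \<noteq> 0 \<and> (\<forall>s\<in>S. y \<bullet> s = 0))"
proof
  assume "dim S < DIM('a)"
  then obtain y where "y \<noteq> 0" "span S \<subseteq> {x. y \<bullet> x = 0}"
    using lowdim_subset_hyperplane[of S] by blast
  then show "\<exists>y. y \<noteq> 0 \<and> (\<forall>s\<in>S. y \<bullet> s = 0)"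
    using span_superset[of S] by blast
next
  assume "\<exists>y. y \<noteq> 0 \<and> (\<forall>s\<in>S. y \<bullet> s = 0)"
  then obtain y where y: "y \<noteq> 0" "S \<subseteq> {x. y \<bullet> x = 0}"
    by blast
  have "dim S \<le> DIM('a) - 1"
    using dim_subset[OF y(2)] dim_hyperplane[OF y(1)] by simp
  then show "dim S < DIM('a)"
    using DIM_positive[where 'a='a] by linarith
qed

text \<open>Trades dimensions for annihilating vectors \<open>y\<close>, the form in which
  \<open>cross2_eq_0_iff\<close> expresses dependence.\<close>

lemma rank_condition_iff:
  "lie_algebra_rank_condition A B \<longleftrightarrow>
    (\<forall>x y. x \<noteq> 0 \<longrightarrow> y \<noteq> 0 \<longrightarrow> (\<exists>C\<in>system_lie_algebra A B. y \<bullet> (C *v x) \<noteq> 0))"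
proof -
  have *: "dim S = 2 \<longleftrightarrow> \<not> (\<exists>y. y \<noteq> 0 \<and> (\<forall>s\<in>S. y \<bullet> s = 0))" for S :: "(real^2) set"
    using dim_less_DIM_iff[of S] dim_subset_UNIV[of S] by auto
  show ?thesis
    unfolding lie_algebra_rank_condition_def lie_algebra_at_def * ball_simps by blast
qed

lemma subspace_system_lie_algebra: "subspace (system_lie_algebra A B)"
  unfolding system_lie_algebra_def hull_def
  by (intro subspace_Inter) (auto simp: lie_subalgebra_def)

text \<open>A basis with fewer than two elements is padded to a pair, by 0 or by repetition.\<close>

lemma spanning_pair:
  fixes L :: "'a::euclidean_space set"
  assumes "subspace L" "dim L \<le> 2"
  obtains u v where "u \<in> L" "v \<in> L" "L \<subseteq> span {u, v}"
proof -
  obtain S where S: "S \<subseteq> L" "independent S" "L \<subseteq> span S" "card S = dim L"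
    by (rule basis_exists)
  then have "finite S"
    using independent_imp_finite by blast
  have "card S = 0 \<or> card S = 1 \<or> card S = 2"
    using S assms by linarith
  then consider "S = {}" | u where "S = {u}" | u v where "S = {u, v}"
    using \<open>finite S\<close> by (metis card_0_eq card_1_singletonE card_2_iff)
  then show ?thesis
  proof cases
    case 1
    then show ?thesis
      using S that[of 0 0] subspace_0[OF assms(1)] by auto
  next
    case (2 u)
    then show ?thesis
      using S that[of u u] by auto
  next
    case (3 u v)
    then show ?thesis
      using S that[of u v] by auto
  qed
qed

lemma singular_mat2_rank_one:
  fixes N :: "real^2^2"
  assumes "N \<noteq> 0" "det N = 0"
  obtains x y where "x \<noteq> 0" "y \<noteq> 0" "\<And>C. y \<bullet> (C *v x) = N \<bullet> C"
proof -
  have d: "N $ 1 $ 1 * N $ 2 $ 2 = N $ 1 $ 2 * N $ 2 $ 1"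
    using assms(2) by (simp add: det_2)
  show ?thesis
  proof (cases "N $ 1 = 0")
    case False
    \<comment> \<open>The rows are proportional; \<open>k\<close> is read off at a nonzero entry of
      the first row.\<close>
    then obtain k where k: "N $ 2 = k *\<^sub>R N $ 1"
    proof (cases "N $ 1 $ 1 = 0")
      case True
      then show ?thesis
        using False d by (intro that[of "N $ 2 $ 2 / N $ 1 $ 2"])
          (auto simp: vec_eq_iff forall_2)
    next
      case False
      then show ?thesis
        using d by (intro that[of "N $ 2 $ 1 / N $ 1 $ 1"])
          (auto simp: vec_eq_iff forall_2 field_simps)
    qed
    show ?thesis
      using False by (intro that[of "N $ 1" "vector [1, k]"])
        (auto simp: k vec2_eq_0_iff inner_vec2 inner_mat2 mult_vec2 algebra_simps)
  next
    case True
    then have "N $ 2 \<noteq> 0"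
      using assms(1) by (auto simp: vec_eq_iff forall_2)
    then show ?thesis
      using True by (intro that[of "N $ 2" "vector [0, 1]"])
        (auto simp: vec2_eq_0_iff inner_vec2 inner_mat2 mult_vec2 algebra_simps)
  qed
qed

lemma transitive_subspace_has_pair:
  fixes L :: "(real^2^2) set"
  assumes L: "subspace L"
    and trans: "\<And>x y. x \<noteq> 0 \<Longrightarrow> y \<noteq> 0 \<Longrightarrow> \<exists>C\<in>L. y \<bullet> (C *v x) \<noteq> 0"
  shows "\<exists>A\<in>L. \<exists>B\<in>L. \<forall>x. x \<noteq> 0 \<longrightarrow> cross2 (A *v x) (B *v x) \<noteq> 0"
proof (cases "dim L \<le> 2")
  case True
  obtain A B where AB: "A \<in> L" "B \<in> L" "L \<subseteq> span {A, B}"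
    using spanning_pair[OF L True] .
  have "cross2 (A *v x) (B *v x) \<noteq> 0" if "x \<noteq> 0" for x
  proof
    assume "cross2 (A *v x) (B *v x) = 0"
    then obtain y where y: "y \<noteq> 0" "y \<bullet> (A *v x) = 0" "y \<bullet> (B *v x) = 0"
      by (auto simp: cross2_eq_0_iff)
    have "y \<bullet> (C *v x) = 0" if "C \<in> span {A, B}" for C
      using that y by (induction rule: span_induct_alt)
        (auto simp: matrix_vector_mult_add_rdistrib scaleR_matrix_vector_assoc[symmetric]
          inner_add_right)
    then show False
      using trans[OF \<open>x \<noteq> 0\<close> y(1)] AB(3) by blast
  qed
  with AB show ?thesis by blast
next
  case False
  \<comment> \<open>Dimensions 3 and 4 are treated alike; in dimension 4 any invertible
    \<open>N\<close> serves, here the identity.\<close>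
  have "\<exists>N. det N \<noteq> 0 \<and> {C. N \<bullet> C = 0} \<subseteq> L"
  proof (cases "dim L < 4")
    case True
    with False have d: "dim L = 3" by linarith
    then obtain N where N: "N \<noteq> 0" "\<forall>C\<in>L. N \<bullet> C = 0"
      using dim_less_DIM_iff[of L] by auto
    have "dim {C. N \<bullet> C = 0} = dim L"
      using d dim_hyperplane[OF N(1)] by simp
    then have eq: "L = {C. N \<bullet> C = 0}"
      using N L by (intro subspace_dim_equal subspace_hyperplane) auto
    have "det N \<noteq> 0"
    proof
      assume "det N = 0"
      then obtain x y where xy: "x \<noteq> 0" "y \<noteq> 0" "\<And>C. y \<bullet> (C *v x) = N \<bullet> C"
        using singular_mat2_rank_one[OF N(1)] by blast
      then show False
        using trans[OF xy(1,2)] N(2) by auto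
    qed
    with eq show ?thesis by blast
  next
    case False
    then have "dim L = dim (UNIV :: (real^2^2) set)"
      using dim_subset_UNIV[of L] by simp
    then have "L = UNIV"
      using L by (intro subspace_dim_equal) auto
    then show ?thesis
      by (intro exI[of _ "mat 1"]) simp
  qed
  then obtain N where N: "det N \<noteq> 0" "{C. N \<bullet> C = 0} \<subseteq> L" by blast
  \<comment> \<open>Both right factors \<open>S\<close> are traceless, so
    \<open>N \<bullet> (adj (transpose N) ** S) = det N * trace S = 0\<close>. They send
    \<open>x\<close> to \<open>(x $ 1, - x $ 2)\<close> and \<open>(x $ 2, x $ 1)\<close>, whose
    \<open>cross2\<close> is the squared norm of \<open>x\<close>; the left factor multiplies it by
    \<open>det N\<close>.\<close>
  define A B :: "real^2^2" where
    "A = adj (transpose N) ** vector [vector [1, 0], vector [0, -1]]" and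
    "B = adj (transpose N) ** vector [vector [0, 1], vector [1, 0]]"
  have "N \<bullet> A = 0" "N \<bullet> B = 0"
    by (simp_all add: inner_mat2 A_def B_def matrix_2_simps transpose_def algebra_simps)
  then have "A \<in> L" "B \<in> L" using N(2) by auto
  moreover have "cross2 (A *v x) (B *v x) = det N * ((x $ 1)\<^sup>2 + (x $ 2)\<^sup>2)" for x
    by (simp add: cross2_def mult_vec2 A_def B_def matrix_2_simps transpose_def
        power2_eq_square algebra_simps)
  ultimately show ?thesis
    using N(1) by (intro bexI[of _ A] bexI[of _ B]) (auto simp: vec2_eq_0_iff sum_power2_eq_zero_iff)
qed

theorem theorem1p1:
  fixes A B :: "real^2^2"
  shows "lie_algebra_rank_condition A B \<longleftrightarrow>
    (\<exists>A' \<in> system_lie_algebra A B. \<exists>B' \<in> system_lie_algebra A B.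
      (trace (adj A' ** B'))\<^sup>2 - 4 * det (adj A' ** B') < 0)"
  unfolding rank_condition_iff discriminant_neg_iff
proof
  assume "\<forall>x y. x \<noteq> 0 \<longrightarrow> y \<noteq> 0 \<longrightarrow> (\<exists>C\<in>system_lie_algebra A B. y \<bullet> (C *v x) \<noteq> 0)"
  then show "\<exists>A'\<in>system_lie_algebra A B. \<exists>B'\<in>system_lie_algebra A B.
      \<forall>x. x \<noteq> 0 \<longrightarrow> cross2 (A' *v x) (B' *v x) \<noteq> 0"
    by (intro transitive_subspace_has_pair subspace_system_lie_algebra) blast
next
  assume "\<exists>A'\<in>system_lie_algebra A B. \<exists>B'\<in>system_lie_algebra A B.
      \<forall>x. x \<noteq> 0 \<longrightarrow> cross2 (A' *v x) (B' *v x) \<noteq> 0"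
  \<comment> \<open>A nonzero \<open>y\<close> annihilating \<open>C *v x\<close> for all
    \<open>C\<close> in the Lie algebra would annihilate \<open>A' *v x\<close> and
    \<open>B' *v x\<close>, forcing their \<open>cross2\<close> to vanish.\<close>
  then show "\<forall>x y. x \<noteq> 0 \<longrightarrow> y \<noteq> 0 \<longrightarrow> (\<exists>C\<in>system_lie_algebra A B. y \<bullet> (C *v x) \<noteq> 0)"
    unfolding cross2_eq_0_iff by blast
qed

end
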